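(* Let $1\le k\le n$ and let $f:\mathbb{F}_2^n\to\mathbb{F}_2$ be a function of algebraic degree exactly $k$. Then \[\prod_{i=1}^{k}\Big(1-\frac{1}{2^i}\Big)\le\mathrm{dt}_k(f)\le\frac12\Big(1-\frac{1}{2^n}\Big)^{k-1}.\] Moreover, the lower bound is attained if and only if $f\sim_{k-1}x_1\cdots x_k$.
   Context: $\oplus$ denotes addition in $\mathbb{F}_2$ and $\mathbb{F}_2^n$. The algebraic degree $\deg(f)$ of $f:\mathbb{F}_2^n\to\mathbb{F}_2$ is the degree of its algebraic normal form (the unique polynomial over $\mathbb{F}_2$ of degree at most one in each variable representing $f$). For $1\le k\le n$, \[\mathrm{dt}_k(f)=\frac{\big|\{(u_0,\dots,u_k)\in(\mathbb{F}_2^n)^{k+1}:\ \bigoplus_{c_1,\dots,c_k\in\mathbb{F}_2} f\big((\bigoplus_{i=1}^k c_iu_i)\oplus u_0\big)\neq0\}\big|}{2^{(k+1)n}}.\] For $M\in GL(n,\mathbb{F}_2)$, $v\in\mathbb{F}_2^n$, $\varphi_{M,v}(x)=Mx\oplus v$; $f\sim g$ means $g=f\circ\varphi_{M,v}$ for some such $M,v$; and $f\sim_{k-1}g$ means there is $h$ with $f\sim h$ and $\deg(g\oplus h)\le k-1$. *)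

theory Defs
  imports Complex_Main "HOL-Library.Z2" "HOL-Library.FuncSet"
begin

text \<open>F_2 is the type bit. Vectors of F_2^n are functions nat => bit vanishing
  outside {0..<n} (coordinate i+1 of the paper is index i here).
  Boolean functions are f :: (nat => bit) => bit, only their values on Vn n matter.\<close>

definition Vn :: "nat \<Rightarrow> (nat \<Rightarrow> bit) set" where
  "Vn n = {x. \<forall>i\<ge>n. x i = 0}"

definition vadd :: "(nat \<Rightarrow> bit) \<Rightarrow> (nat \<Rightarrow> bit) \<Rightarrow> (nat \<Rightarrow> bit)" where
  "vadd x y = (\<lambda>i. x i + y i)"

definition is_anf :: "nat \<Rightarrow> (nat set \<Rightarrow> bit) \<Rightarrow> ((nat \<Rightarrow> bit) \<Rightarrow> bit) \<Rightarrow> bool" where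
  "is_anf n a f \<longleftrightarrow> (\<forall>S. \<not> S \<subseteq> {..<n} \<longrightarrow> a S = 0) \<and>
     (\<forall>x\<in>Vn n. f x = (\<Sum>S\<in>Pow {..<n}. a S * (\<Prod>i\<in>S. x i)))"

definition anf :: "nat \<Rightarrow> ((nat \<Rightarrow> bit) \<Rightarrow> bit) \<Rightarrow> (nat set \<Rightarrow> bit)" where
  "anf n f = (THE a. is_anf n a f)"

text \<open>Algebraic degree (the zero function gets degree 0).\<close>
definition deg :: "nat \<Rightarrow> ((nat \<Rightarrow> bit) \<Rightarrow> bit) \<Rightarrow> nat" where
  "deg n f = Max ({card S | S. S \<subseteq> {..<n} \<and> anf n f S \<noteq> 0} \<union> {0})"

definition kder :: "nat \<Rightarrow> ((nat \<Rightarrow> bit) \<Rightarrow> bit) \<Rightarrow> (nat \<Rightarrow> nat \<Rightarrow> bit) \<Rightarrow> bit" where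
  "kder k f u = (\<Sum>c\<in>PiE {1..k} (\<lambda>_. UNIV :: bit set).
       f (\<lambda>j. (\<Sum>i\<in>{1..k}. c i * u i j) + u 0 j))"

definition dt :: "nat \<Rightarrow> nat \<Rightarrow> ((nat \<Rightarrow> bit) \<Rightarrow> bit) \<Rightarrow> real" where
  "dt n k f = real (card {u \<in> PiE {0..k} (\<lambda>_. Vn n). kder k f u \<noteq> 0}) / 2 ^ ((k + 1) * n)"

text \<open>n x n matrices over F_2 as nat => nat => bit (only entries below n matter).\<close>
definition mat_mult :: "nat \<Rightarrow> (nat \<Rightarrow> nat \<Rightarrow> bit) \<Rightarrow> (nat \<Rightarrow> nat \<Rightarrow> bit) \<Rightarrow> (nat \<Rightarrow> nat \<Rightarrow> bit)" where
  "mat_mult n A B = (\<lambda>i j. \<Sum>l<n. A i l * B l j)"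

definition GL :: "nat \<Rightarrow> (nat \<Rightarrow> nat \<Rightarrow> bit) \<Rightarrow> bool" where
  "GL n M \<longleftrightarrow> (\<exists>N. \<forall>i<n. \<forall>j<n.
      mat_mult n M N i j = (if i = j then 1 else 0) \<and> mat_mult n N M i j = (if i = j then 1 else 0))"

definition affmap :: "nat \<Rightarrow> (nat \<Rightarrow> nat \<Rightarrow> bit) \<Rightarrow> (nat \<Rightarrow> bit) \<Rightarrow> (nat \<Rightarrow> bit) \<Rightarrow> (nat \<Rightarrow> bit)" where
  "affmap n M v x = (\<lambda>j. if j < n then (\<Sum>i<n. M j i * x i) + v j else 0)"

definition affeq :: "nat \<Rightarrow> ((nat \<Rightarrow> bit) \<Rightarrow> bit) \<Rightarrow> ((nat \<Rightarrow> bit) \<Rightarrow> bit) \<Rightarrow> bool" where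
  "affeq n f g \<longleftrightarrow> (\<exists>M v. GL n M \<and> v \<in> Vn n \<and> (\<forall>x\<in>Vn n. g x = f (affmap n M v x)))"

definition affeq_deg :: "nat \<Rightarrow> nat \<Rightarrow> ((nat \<Rightarrow> bit) \<Rightarrow> bit) \<Rightarrow> ((nat \<Rightarrow> bit) \<Rightarrow> bit) \<Rightarrow> bool" where
  "affeq_deg n d f g \<longleftrightarrow> (\<exists>h. affeq n f h \<and> deg n (\<lambda>x. g x + h x) \<le> d)"

end

theory Submission
  imports Defs "HOL-Library.Function_Algebras"
begin

text \<open>
  If \<open>f\<close> has degree \<open>k\<close>, its \<open>k\<close>-fold derivative does not depend on the base point and is a
  nonzero alternating \<open>k\<close>-linear form in the directions. Let \<open>R\<close> be the radical of this form, i.e.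
  the directions \<open>u\<close> for which the derivative of \<open>f\<close> along \<open>u\<close> has degree less than \<open>k - 1\<close>.
  For \<open>u\<close> outside \<open>R\<close> the radical of the derivative along \<open>u\<close> contains \<open>R\<close> and \<open>u\<close>, hence is at
  least twice as large; by induction \<open>R\<close> has codimension at least \<open>k\<close>. Averaging over the first
  direction, which must avoid \<open>R\<close>, gives the lower bound, with equality iff the codimension is
  exactly \<open>k\<close>. In that case a basis of \<open>R\<close> extended to the whole space is a coordinate system in
  which \<open>f\<close> has a single monomial of degree \<open>k\<close>. The upper bound only uses that no direction may
  be zero and that a linear functional is nonzero on at most half of the space.
\<close>

\<comment> \<open>These rules replace the field operations by xor/and and so block ring reasoning.\<close>
declare add_bit_eq_xor [simp del] mult_bit_eq_and [simp del]

lemma bitfun_add_self [simp]: "x + x = 0" for x :: "'a \<Rightarrow> bit"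
  by (simp add: fun_eq_iff)

lemma bitfun_add_self_left [simp]: "x + (x + y) = y" for x y :: "'a \<Rightarrow> bit"
  by (simp flip: add.assoc)

lemma sum_UNIV_bit: "(\<Sum>y\<in>UNIV. g y) = g 0 + g 1" for g :: "bit \<Rightarrow> 'a::comm_monoid_add"
proof -
  have UNIV_bit: "(UNIV :: bit set) = {0, 1}"
    using bit.exhaust by auto
  show ?thesis
    unfolding UNIV_bit by simp
qed

lemma sum_fun_apply: "(\<Sum>i\<in>I. b i) j = (\<Sum>i\<in>I. b i j)" for b :: "'a \<Rightarrow> 'b \<Rightarrow> 'c::comm_monoid_add"
  by (induction I rule: infinite_finite_induct) simp_all

subsection \<open>Vector spaces of functions\<close>

definition scale_fun :: "'b::times \<Rightarrow> ('a \<Rightarrow> 'b) \<Rightarrow> 'a \<Rightarrow> 'b" where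
  "scale_fun c x = (\<lambda>i. c * x i)"

interpretation fun_space: vector_space "scale_fun :: 'b::field \<Rightarrow> ('a \<Rightarrow> 'b) \<Rightarrow> 'a \<Rightarrow> 'b"
  by standard (simp_all add: scale_fun_def fun_eq_iff algebra_simps)

lemma scale_fun_bit: "scale_fun c x = (if c = 1 then x else 0)" for c :: bit
  by (cases c) (simp_all add: scale_fun_def fun_eq_iff)

lemma bit_subspaceI:
  fixes U :: "('a \<Rightarrow> bit) set"
  assumes "0 \<in> U" and "\<And>x y. x \<in> U \<Longrightarrow> y \<in> U \<Longrightarrow> x + y \<in> U"
  shows "fun_space.subspace U"
  using assms by (intro fun_space.subspaceI) (simp_all add: scale_fun_bit)

lemma double_card_subspace_le:
  fixes U W :: "('a \<Rightarrow> 'b::field) set"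
  assumes U: "fun_space.subspace U" and W: "fun_space.subspace W"
    and "U \<subseteq> W" "finite W" and v: "v \<in> W" "v \<notin> U"
  shows "2 * card U \<le> card W"
proof -
  have "v + x \<notin> U" if "x \<in> U" for x
    using fun_space.subspace_diff[OF U, of "v + x" x] that v(2) by auto
  then have "U \<inter> (+) v ` U = {}"
    by auto
  then have "2 * card U = card (U \<union> (+) v ` U)"
    using finite_subset[OF assms(3,4)] by (simp add: card_Un_disjoint card_image)
  also have "U \<union> (+) v ` U \<subseteq> W"
    using fun_space.subspace_add[OF W v(1)] \<open>U \<subseteq> W\<close> by auto
  then have "card (U \<union> (+) v ` U) \<le> card W"
    by (rule card_mono[OF \<open>finite W\<close>])
  finally show ?thesis .
qed

lemma bij_betw_subset_sums_span:
  fixes B :: "('a \<Rightarrow> bit) set"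
  assumes "finite B" and indep: "fun_space.independent B"
  shows "bij_betw \<Sum> (Pow B) (fun_space.span B)"
proof -
  have subset_sum: "(\<Sum>v\<in>B. scale_fun (of_bool (v \<in> S)) v) = \<Sum>S" if "S \<subseteq> B" for S
    using that assms(1) by (simp add: scale_fun_bit Int_absorb1 flip: sum.inter_restrict)
  have "S = T" if ST: "S \<subseteq> B" "T \<subseteq> B" "\<Sum>S = \<Sum>T" for S T
  proof -
    have "(\<Sum>v\<in>B. scale_fun (of_bool (v \<in> S) - of_bool (v \<in> T)) v) = \<Sum>S - \<Sum>T"
      using subset_sum ST(1,2) by (simp only: fun_space.scale_left_diff_distrib sum_subtractf)
    also have "\<dots> = 0"
      unfolding ST(3) by (rule diff_self)
    finally have "of_bool (v \<in> S) - of_bool (v \<in> T) = (0::bit)" if "v \<in> B" for v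
      using fun_space.independentD[OF indep assms(1) subset_refl,
          where u = "\<lambda>v. of_bool (v \<in> S) - of_bool (v \<in> T)"] that by blast
    then have "v \<in> S \<longleftrightarrow> v \<in> T" if "v \<in> B" for v
      using that by (simp only: right_minus_eq of_bool_eq_iff)
    with ST show ?thesis by blast
  qed
  moreover have "x \<in> \<Sum> ` Pow B" if x: "x \<in> fun_space.span B" for x
  proof -
    obtain c where "x = (\<Sum>v\<in>B. scale_fun (c v) v)"
      using x fun_space.span_finite[OF assms(1)] by auto
    also have "\<dots> = \<Sum>{v \<in> B. c v = 1}"
      using assms(1) by (simp add: scale_fun_bit sum.inter_filter)
    finally show ?thesis
      by (rule image_eqI) simp
  qed
  moreover have "\<Sum>S \<in> fun_space.span B" if "S \<subseteq> B" for S
    using that by (intro fun_space.span_sum fun_space.span_base) auto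
  ultimately show ?thesis
    unfolding bij_betw_def by (intro conjI inj_onI equalityI subsetI) auto
qed

lemma bij_betw_indexed_subset_sums_span:
  fixes B :: "('a \<Rightarrow> bit) set"
  assumes b: "bij_betw b I B" and B: "finite B" "fun_space.independent B"
  shows "bij_betw (\<lambda>S. \<Sum>j\<in>S. b j) (Pow I) (fun_space.span B)"
proof -
  have "(\<Sum>j\<in>S. b j) = (\<Sum> \<circ> image b) S" if "S \<in> Pow I" for S
    using that inj_on_subset[OF bij_betw_imp_inj_on[OF b]] by (simp add: sum.reindex)
  then have "bij_betw (\<lambda>S. \<Sum>j\<in>S. b j) (Pow I) (fun_space.span B) \<longleftrightarrow>
      bij_betw (\<Sum> \<circ> image b) (Pow I) (fun_space.span B)"
    by (rule bij_betw_cong)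
  then show ?thesis
    using bij_betw_trans[OF bij_betw_image_Pow[OF b] bij_betw_subset_sums_span[OF B]] by blast
qed

lemma card_span:
  fixes B :: "('a \<Rightarrow> bit) set"
  assumes "finite B" "fun_space.independent B"
  shows "card (fun_space.span B) = 2 ^ card B"
  using bij_betw_same_card[OF bij_betw_subset_sums_span[OF assms]] assms(1) by (simp add: card_Pow)

subsection \<open>The space \<open>F_2^n\<close>\<close>

definition ind :: "'a set \<Rightarrow> 'a \<Rightarrow> bit" where
  "ind S = (\<lambda>i. of_bool (i \<in> S))"

lemma ind_eq_sum_units: "finite S \<Longrightarrow> ind S = (\<Sum>i\<in>S. ind {i})"
  by (auto simp: ind_def fun_eq_iff sum_fun_apply of_bool_def)

lemma subspace_Vn: "fun_space.subspace (Vn n)"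
  by (rule bit_subspaceI) (simp_all add: Vn_def)

lemma zero_in_Vn [simp]: "0 \<in> Vn n"
  by (rule fun_space.subspace_0[OF subspace_Vn])

lemma add_in_Vn [simp]: "x \<in> Vn n \<Longrightarrow> y \<in> Vn n \<Longrightarrow> x + y \<in> Vn n"
  by (rule fun_space.subspace_add[OF subspace_Vn])

lemma ind_in_Vn_iff [simp]: "ind S \<in> Vn n \<longleftrightarrow> S \<subseteq> {..<n}"
  by (auto simp: Vn_def ind_def) (meson leI)

lemma bij_betw_ind: "bij_betw ind (Pow {..<n}) (Vn n)"
proof (rule bij_betw_byWitness[where f' = "\<lambda>x. {i. x i = 1}"])
  show "\<forall>x\<in>Vn n. ind {i. x i = 1} = x"
    by (auto simp: ind_def fun_eq_iff simp flip: bit_not_one_iff)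
  show "(\<lambda>x. {i. x i = 1}) ` Vn n \<subseteq> Pow {..<n}"
    by (auto simp: Vn_def) (metis leI zero_neq_one)
  show "ind ` Pow {..<n} \<subseteq> Vn n"
    by auto
qed (simp add: ind_def)

lemma ball_Vn_iff: "(\<forall>x\<in>Vn n. P x) \<longleftrightarrow> (\<forall>S\<subseteq>{..<n}. P (ind S))"
  unfolding bij_betw_imp_surj_on[OF bij_betw_ind, symmetric] by auto

lemma finite_Vn [simp]: "finite (Vn n)"
  using bij_betw_finite[OF bij_betw_ind] by blast

lemma card_Vn: "card (Vn n) = 2 ^ n"
  using bij_betw_same_card[OF bij_betw_ind, of n] by (simp add: card_Pow)

lemma Vn_subset_subspace:
  assumes "fun_space.subspace U" and "\<And>i. i < n \<Longrightarrow> ind {i} \<in> U"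
  shows "Vn n \<subseteq> U"
proof -
  have "ind S \<in> U" if "S \<subseteq> {..<n}" for S
  proof -
    have "(\<Sum>i\<in>S. ind {i}) \<in> U"
      using assms that by (intro fun_space.subspace_sum) auto
    then show ?thesis
      using that by (simp add: ind_eq_sum_units[of S] finite_subset)
  qed
  then show ?thesis
    using ball_Vn_iff[of n "\<lambda>x. x \<in> U"] by blast
qed

subsection \<open>Derivatives and degree\<close>

definition der :: "(nat \<Rightarrow> bit) \<Rightarrow> ((nat \<Rightarrow> bit) \<Rightarrow> bit) \<Rightarrow> (nat \<Rightarrow> bit) \<Rightarrow> bit" where
  "der u f = (\<lambda>x. f (x + u) + f x)"

lemma der_commute: "der u (der v f) = der v (der u f)"
  by (simp add: der_def fun_eq_iff add_ac)

lemma der_add_fun: "der u (f + g) = der u f + der u g"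
  by (simp add: der_def fun_eq_iff add_ac)

lemma der_add: "der (u + v) f = der u f + der v f + der u (der v f)"
  by (simp add: der_def fun_eq_iff add_ac)

lemma der_self [simp]: "der u (der u f) = 0"
  by (simp add: der_def fun_eq_iff add_ac)

lemma der_zero [simp]: "der 0 f = 0" "der u 0 = 0"
  by (simp_all add: der_def fun_eq_iff)

text \<open>Degree smaller than \<open>d\<close>, expressed by the vanishing of all \<open>d\<close>-fold derivatives; thus
  \<open>deg_lt n 0\<close> singles out the zero function.\<close>
primrec deg_lt :: "nat \<Rightarrow> nat \<Rightarrow> ((nat \<Rightarrow> bit) \<Rightarrow> bit) \<Rightarrow> bool" where
  deg_lt_0: "deg_lt n 0 f \<longleftrightarrow> (\<forall>x\<in>Vn n. f x = 0)"
| deg_lt_Suc: "deg_lt n (Suc d) f \<longleftrightarrow> (\<forall>u\<in>Vn n. deg_lt n d (der u f))"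

declare deg_lt.simps [simp del]

lemma deg_lt_cong: "(\<And>x. x \<in> Vn n \<Longrightarrow> f x = g x) \<Longrightarrow> deg_lt n d f \<longleftrightarrow> deg_lt n d g"
proof (induction d arbitrary: f g)
  case (Suc d)
  have "deg_lt n d (der u f) \<longleftrightarrow> deg_lt n d (der u g)" if "u \<in> Vn n" for u
    using that by (intro Suc.IH) (simp only: der_def Suc.prems add_in_Vn)
  then show ?case by (simp add: deg_lt_Suc)
qed (simp add: deg_lt_0)

lemma deg_lt_zero [simp]: "deg_lt n d 0"
proof (induction d)
  case (Suc d)
  then show ?case unfolding deg_lt_Suc der_zero by blast
qed (simp add: deg_lt_0)

lemma deg_lt_add: "deg_lt n d f \<Longrightarrow> deg_lt n d g \<Longrightarrow> deg_lt n d (f + g)"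
  by (induction d arbitrary: f g) (simp_all add: deg_lt.simps der_add_fun)

lemma deg_lt_imp_deg_lt_Suc: "deg_lt n d f \<Longrightarrow> deg_lt n (Suc d) f"
proof (induction d arbitrary: f)
  case 0
  then show ?case by (simp add: deg_lt.simps der_def)
next
  case (Suc d)
  then show ?case by (metis deg_lt_Suc)
qed

lemma deg_lt_mono: "deg_lt n d f \<Longrightarrow> d \<le> e \<Longrightarrow> deg_lt n e f"
  by (rule dec_induct[of d e "\<lambda>e. deg_lt n e f"]) (simp_all add: deg_lt_imp_deg_lt_Suc)

lemma deg_lt_der: "deg_lt n d f \<Longrightarrow> u \<in> Vn n \<Longrightarrow> deg_lt n (d - 1) (der u f)"
  using deg_lt_mono[of n d f "Suc (d - 1)"] by (simp add: deg_lt_Suc)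

text \<open>In contrast to \<^const>\<open>deg\<close>, which assigns degree 0 to the zero function, the zero function
  has no degree in this sense.\<close>
definition has_degree :: "nat \<Rightarrow> nat \<Rightarrow> ((nat \<Rightarrow> bit) \<Rightarrow> bit) \<Rightarrow> bool" where
  "has_degree n k f \<longleftrightarrow> deg_lt n (Suc k) f \<and> \<not> deg_lt n k f"

lemma has_degree_0_imp_eq_1:
  assumes "has_degree n 0 f" "x \<in> Vn n"
  shows "f x = 1"
proof -
  have f_constant: "f y = f 0" if "y \<in> Vn n" for y
  proof -
    have "der y f 0 = 0"
      using assms(1) that by (simp add: has_degree_def deg_lt.simps)
    then show ?thesis
      by (cases "f y"; cases "f 0") (simp_all add: der_def)
  qed
  obtain y where "y \<in> Vn n" "f y = 1"
    using assms(1) by (auto simp: has_degree_def deg_lt_0)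
  then show ?thesis
    using f_constant assms(2) by metis
qed

subsection \<open>The radical\<close>

text \<open>For \<open>f\<close> of degree \<open>k\<close> this is the radical of the alternating form given by the
  \<open>k\<close>-fold derivative. For \<open>k = 0\<close> truncated subtraction makes it all of \<open>Vn n\<close> when \<open>f\<close> is
  constant, which is the correct base case of the inductions.\<close>
definition radical :: "nat \<Rightarrow> nat \<Rightarrow> ((nat \<Rightarrow> bit) \<Rightarrow> bit) \<Rightarrow> (nat \<Rightarrow> bit) set" where
  "radical n k f = {u \<in> Vn n. deg_lt n (k - 1) (der u f)}"

lemma radical_subset: "radical n k f \<subseteq> Vn n"
  by (auto simp: radical_def)

lemma finite_radical [simp]: "finite (radical n k f)"
  using radical_subset finite_Vn by (rule finite_subset)

lemma subspace_radical: "fun_space.subspace (radical n k f)"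
proof (rule bit_subspaceI)
  fix u v assume "u \<in> radical n k f" "v \<in> radical n k f"
  then have u: "u \<in> Vn n" "deg_lt n (k - 1) (der u f)"
    and v: "v \<in> Vn n" "deg_lt n (k - 1) (der v f)"
    by (simp_all add: radical_def)
  have "deg_lt n (k - 1) (der u (der v f))"
    using deg_lt_der[OF v(2) u(1)] by (rule deg_lt_mono) simp
  with u v show "u + v \<in> radical n k f"
    by (simp add: radical_def der_add deg_lt_add)
qed (simp add: radical_def)

lemma radical_subset_radical_der:
  "u \<in> Vn n \<Longrightarrow> radical n (Suc k) f \<subseteq> radical n k (der u f)"
  using deg_lt_der[of n k _ u] by (auto simp: radical_def der_commute[of _ u])

lemma direction_in_radical_der: "u \<in> Vn n \<Longrightarrow> u \<in> radical n k (der u f)"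
  by (simp add: radical_def)

lemma radical_cong:
  assumes "deg_lt n k (f + g)"
  shows "radical n k f = radical n k g"
proof -
  have "deg_lt n (k - 1) (der u f) \<longleftrightarrow> deg_lt n (k - 1) (der u g)" if "u \<in> Vn n" for u
  proof -
    have "der u g = der u f + der u (f + g)" "der u f = der u g + der u (f + g)"
      by (simp_all add: der_add_fun add_ac)
    then show ?thesis
      using deg_lt_der[OF assms that] deg_lt_add by metis
  qed
  then show ?thesis by (auto simp: radical_def)
qed

lemma has_degree_der:
  "has_degree n (Suc k) f \<Longrightarrow> u \<in> Vn n - radical n (Suc k) f \<Longrightarrow> has_degree n k (der u f)"
  by (auto simp: has_degree_def radical_def deg_lt_Suc[of n "Suc k"])

lemma deg_lt_Suc_iff_units:
  "deg_lt n (Suc d) f \<longleftrightarrow> (\<forall>i<n. deg_lt n d (der (ind {i}) f))"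
proof
  assume "\<forall>i<n. deg_lt n d (der (ind {i}) f)"
  then have "Vn n \<subseteq> radical n (Suc d) f"
    by (intro Vn_subset_subspace subspace_radical) (simp add: radical_def)
  then show "deg_lt n (Suc d) f"
    by (auto simp: radical_def deg_lt_Suc)
qed (simp add: deg_lt_Suc)

subsection \<open>Algebraic normal form\<close>

lemma bit_sum_Pow_sum_Pow:
  fixes a :: "'a set \<Rightarrow> bit"
  assumes "finite S"
  shows "(\<Sum>T\<in>Pow S. sum a (Pow T)) = a S"
  using inclusion_exclusion_mobius[of "\<lambda>T. sum a (Pow T)" a S] assms by simp

text \<open>The coefficient of the monomial \<open>S\<close> in the algebraic normal form, by Moebius inversion.\<close>
definition moebius :: "((nat \<Rightarrow> bit) \<Rightarrow> bit) \<Rightarrow> nat set \<Rightarrow> bit" where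
  "moebius f S = (\<Sum>T\<in>Pow S. f (ind T))"

abbreviation monomial :: "nat set \<Rightarrow> (nat \<Rightarrow> bit) \<Rightarrow> bit" where
  "monomial S \<equiv> (\<lambda>x. \<Prod>i\<in>S. x i)"

lemma sum_moebius: "finite T \<Longrightarrow> (\<Sum>S\<in>Pow T. moebius f S) = f (ind T)"
  using bit_sum_Pow_sum_Pow[of T "\<lambda>S. f (ind S)"] by (simp add: moebius_def)

lemma moebius_add: "moebius (f + g) S = moebius f S + moebius g S"
  by (simp add: moebius_def sum.distrib)

lemma moebius_zero [simp]: "moebius 0 S = 0"
  by (simp add: moebius_def)

lemma monomial_ind: "finite S \<Longrightarrow> monomial S (ind T) = of_bool (S \<subseteq> T)"
  by (induction S rule: finite_induct) (auto simp: ind_def)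

lemma moebius_monomial:
  assumes "finite S" "finite T"
  shows "moebius (monomial S) T = of_bool (T = S)"
proof -
  have "moebius (monomial S) T = (\<Sum>U\<in>Pow T. \<Sum>V\<in>Pow U. of_bool (V = S))"
    unfolding moebius_def using assms
    by (intro sum.cong refl) (auto simp: monomial_ind of_bool_def finite_subset)
  then show ?thesis
    using bit_sum_Pow_sum_Pow[OF assms(2)] by simp
qed

lemma moebius_insert:
  assumes "finite S" "i \<notin> S"
  shows "moebius f (insert i S) = moebius (der (ind {i}) f) S"
proof -
  have "(\<Sum>T\<in>insert i ` Pow S. f (ind T)) = (\<Sum>T\<in>Pow S. f (ind (insert i T)))"
    using assms by (subst sum.reindex) (auto simp: inj_on_def)
  also have "\<dots> = (\<Sum>T\<in>Pow S. f (ind T + ind {i}))"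
    using assms by (intro sum.cong arg_cong[of _ _ f]) (auto simp: ind_def fun_eq_iff)
  finally have "moebius f (insert i S) = (\<Sum>T\<in>Pow S. f (ind T)) + (\<Sum>T\<in>Pow S. f (ind T + ind {i}))"
    unfolding moebius_def Pow_insert using assms by (subst sum.union_disjoint) auto
  then show ?thesis
    by (simp add: moebius_def der_def sum.distrib add.commute)
qed

lemma moebius_remove:
  "finite S \<Longrightarrow> i \<in> S \<Longrightarrow> moebius f S = moebius (der (ind {i}) f) (S - {i})"
  using moebius_insert[of "S - {i}" i f] by (simp add: insert_absorb)

lemma moebius_der_unit_eq_0: "finite S \<Longrightarrow> i \<in> S \<Longrightarrow> moebius (der (ind {i}) f) S = 0"
  by (simp add: moebius_remove)

lemma sum_monomial_ind:
  assumes "finite V" "T \<subseteq> V"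
  shows "(\<Sum>S\<in>Pow V. a S * monomial S (ind T)) = sum a (Pow T)"
proof -
  have "(\<Sum>S\<in>Pow V. a S * monomial S (ind T)) = (\<Sum>S\<in>Pow V. if S \<in> Pow T then a S else 0)"
    using assms(1) by (intro sum.cong) (auto simp: monomial_ind finite_subset)
  also have "\<dots> = (\<Sum>S\<in>Pow V \<inter> Pow T. a S)"
    using assms(1) by (simp add: sum.inter_restrict)
  also have "Pow V \<inter> Pow T = Pow T"
    using assms(2) by auto
  finally show ?thesis .
qed

lemma eq_sum_Pow_iff_eq_moebius:
  assumes "finite V"
  shows "(\<forall>T\<subseteq>V. f (ind T) = sum a (Pow T)) \<longleftrightarrow> (\<forall>S\<subseteq>V. a S = moebius f S)"
proof (intro iffI allI impI)
  fix S assume f: "\<forall>T\<subseteq>V. f (ind T) = sum a (Pow T)" and S: "S \<subseteq> V"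
  have "moebius f S = (\<Sum>T\<in>Pow S. sum a (Pow T))"
    unfolding moebius_def using f S by (intro sum.cong) auto
  then show "a S = moebius f S"
    using bit_sum_Pow_sum_Pow[of S a] finite_subset[OF S assms] by simp
next
  fix T assume a: "\<forall>S\<subseteq>V. a S = moebius f S" and T: "T \<subseteq> V"
  have "sum a (Pow T) = (\<Sum>S\<in>Pow T. moebius f S)"
    using a T by (intro sum.cong) auto
  then show "f (ind T) = sum a (Pow T)"
    using finite_subset[OF T assms] by (simp add: sum_moebius)
qed

lemma is_anf_iff: "is_anf n a f \<longleftrightarrow> a = (\<lambda>S. if S \<subseteq> {..<n} then moebius f S else 0)"
proof -
  have "is_anf n a f \<longleftrightarrow> (\<forall>S. \<not> S \<subseteq> {..<n} \<longrightarrow> a S = 0) \<and> (\<forall>S\<subseteq>{..<n}. a S = moebius f S)"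
    unfolding is_anf_def ball_Vn_iff
    by (simp add: sum_monomial_ind eq_sum_Pow_iff_eq_moebius[symmetric])
  then show ?thesis by (auto simp: fun_eq_iff)
qed

lemma anf_eq_moebius: "anf n f = (\<lambda>S. if S \<subseteq> {..<n} then moebius f S else 0)"
  by (simp add: anf_def is_anf_iff)

lemma deg_le_iff_moebius:
  "deg n f \<le> d \<longleftrightarrow> (\<forall>S\<subseteq>{..<n}. d < card S \<longrightarrow> moebius f S = 0)"
proof -
  have "finite {card S | S. S \<subseteq> {..<n} \<and> anf n f S \<noteq> 0}"
    by (rule finite_subset[of _ "card ` Pow {..<n}"]) auto
  then have "deg n f \<le> d \<longleftrightarrow> (\<forall>S. S \<subseteq> {..<n} \<and> anf n f S \<noteq> 0 \<longrightarrow> card S \<le> d)"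
    unfolding deg_def by (subst Max_le_iff) auto
  also have "\<dots> \<longleftrightarrow> (\<forall>S\<subseteq>{..<n}. d < card S \<longrightarrow> moebius f S = 0)"
    by (auto simp: anf_eq_moebius linorder_not_le)
  finally show ?thesis .
qed

lemma deg_lt_iff_moebius:
  "deg_lt n d f \<longleftrightarrow> (\<forall>S\<subseteq>{..<n}. d \<le> card S \<longrightarrow> moebius f S = 0)"
proof (induction d arbitrary: f)
  case 0
  show ?case
    using eq_sum_Pow_iff_eq_moebius[of "{..<n}" f "\<lambda>_. 0"] by (auto simp: deg_lt_0 ball_Vn_iff)
next
  case (Suc d)
  have fin: "finite S" if "S \<subseteq> {..<n}" for S
    using that finite_subset by blast
  have "(\<forall>i<n. \<forall>S\<subseteq>{..<n}. d \<le> card S \<longrightarrow> moebius (der (ind {i}) f) S = 0)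
      \<longleftrightarrow> (\<forall>S\<subseteq>{..<n}. Suc d \<le> card S \<longrightarrow> moebius f S = 0)" (is "?units \<longleftrightarrow> ?all")
  proof (intro iffI allI impI)
    fix S assume units: ?units and S: "S \<subseteq> {..<n}" "Suc d \<le> card S"
    then obtain i where i: "i \<in> S" by fastforce
    have "i < n" "S - {i} \<subseteq> {..<n}" "d \<le> card (S - {i})"
      using i S fin[OF S(1)] by auto
    with units have "moebius (der (ind {i}) f) (S - {i}) = 0"
      by blast
    then show "moebius f S = 0"
      using moebius_remove[OF fin[OF S(1)] i] by simp
  next
    fix i S assume ?all "i < n" and S: "S \<subseteq> {..<n}" "d \<le> card S"
    then show "moebius (der (ind {i}) f) S = 0"
      using moebius_der_unit_eq_0[OF fin[OF S(1)], of i f] moebius_insert[OF fin[OF S(1)], of i f]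
        fin[OF S(1)]
      by (cases "i \<in> S") auto
  qed
  then show ?case
    by (simp add: deg_lt_Suc_iff_units Suc.IH)
qed

lemma deg_le_iff_deg_lt: "deg n f \<le> d \<longleftrightarrow> deg_lt n (Suc d) f"
  by (simp add: deg_le_iff_moebius deg_lt_iff_moebius Suc_le_eq)

lemma has_degree_iff_deg: "1 \<le> k \<Longrightarrow> has_degree n k f \<longleftrightarrow> deg n f = k"
  using deg_le_iff_deg_lt[of n f k] deg_le_iff_deg_lt[of n f "k - 1"] by (auto simp: has_degree_def)

lemma moebius_eq_0_if_unit_in_radical:
  assumes "ind {j} \<in> radical n k f" "j \<in> S" "S \<subseteq> {..<n}" "k \<le> card S"
  shows "moebius f S = 0"
proof -
  have fin: "finite S"
    using assms(3) finite_subset by blast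
  have "S - {j} \<subseteq> {..<n}" "k - 1 \<le> card (S - {j})"
    using assms(2-4) fin by auto
  then have "moebius (der (ind {j}) f) (S - {j}) = 0"
    using assms(1) unfolding radical_def deg_lt_iff_moebius by blast
  then show ?thesis
    by (simp add: moebius_remove[OF fin assms(2)])
qed

lemma ind_in_radical_monomial:
  assumes "T \<subseteq> {..<n} - S"
  shows "ind T \<in> radical n k (monomial S)"
proof -
  have "monomial S (x + ind T) = monomial S x" for x
    using assms by (intro prod.cong) (auto simp: ind_def)
  then have "der (ind T) (monomial S) = 0"
    by (simp add: der_def fun_eq_iff)
  then show ?thesis
    using assms by (auto simp: radical_def)
qed

lemma deg_lt_monomial_add:
  assumes S: "S \<subseteq> {..<n}" and f: "\<not> deg_lt n (card S) f"
    and radical: "\<And>j. j \<in> {..<n} - S \<Longrightarrow> ind {j} \<in> radical n (card S) f"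
  shows "deg_lt n (card S) (monomial S + f)"
proof -
  have fin: "finite S"
    using S finite_subset by blast
  have moebius_other: "moebius f T = 0" if T: "T \<subseteq> {..<n}" "card S \<le> card T" "T \<noteq> S" for T
  proof -
    have "\<not> T \<subseteq> S"
      using card_seteq[OF fin, of T] T(2,3) by blast
    then obtain j where "j \<in> T" "j \<in> {..<n} - S"
      using T(1) by blast
    then show ?thesis
      using moebius_eq_0_if_unit_in_radical radical T by blast
  qed
  have moebius_S: "moebius f S = 1"
  proof (rule ccontr)
    assume "moebius f S \<noteq> 1"
    then have "deg_lt n (card S) f"
      unfolding deg_lt_iff_moebius using moebius_other by (metis bit_not_one_iff)
    with f show False ..
  qed
  have "moebius (monomial S + f) T = 0" if "T \<subseteq> {..<n}" "card S \<le> card T" for T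
    using that moebius_other moebius_S fin
    by (cases "T = S") (auto simp: moebius_add moebius_monomial finite_subset)
  then show ?thesis
    by (simp add: deg_lt_iff_moebius)
qed

subsection \<open>The density of the radical\<close>

definition radical_density :: "nat \<Rightarrow> nat \<Rightarrow> ((nat \<Rightarrow> bit) \<Rightarrow> bit) \<Rightarrow> real" where
  "radical_density n k f = card (radical n k f) / 2 ^ n"

lemma radical_density_le_1: "radical_density n k f \<le> 1"
  using card_mono[OF finite_Vn radical_subset, of n k f] by (simp add: radical_density_def card_Vn)

lemma card_Diff_radical: "real (card (Vn n - radical n k f)) = (1 - radical_density n k f) * 2 ^ n"
  using card_mono[OF finite_Vn radical_subset, of n k f]
  by (simp add: card_Diff_subset radical_subset card_Vn radical_density_def left_diff_distrib)

lemma radical_density_der: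
  assumes "u \<in> Vn n - radical n (Suc k) f"
  shows "2 * radical_density n (Suc k) f \<le> radical_density n k (der u f)"
proof -
  have "2 * card (radical n (Suc k) f) \<le> card (radical n k (der u f))"
    using assms
    by (intro double_card_subspace_le[of _ _ u] subspace_radical radical_subset_radical_der
        direction_in_radical_der finite_radical) auto
  then have "real (2 * card (radical n (Suc k) f)) \<le> real (card (radical n k (der u f)))"
    by (rule of_nat_mono)
  then show ?thesis
    by (simp add: radical_density_def divide_right_mono)
qed

lemma radical_density_le: "\<not> deg_lt n k f \<Longrightarrow> radical_density n k f \<le> 1 / 2 ^ k"
proof (induction k arbitrary: f)
  case 0
  then show ?case by (simp add: radical_density_le_1)
next
  case (Suc k)
  then obtain u where u: "u \<in> Vn n" "\<not> deg_lt n k (der u f)"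
    by (auto simp: deg_lt_Suc)
  then have "2 * radical_density n (Suc k) f \<le> radical_density n k (der u f)"
    by (intro radical_density_der) (simp add: radical_def)
  also have "\<dots> \<le> 1 / 2 ^ k"
    using u(2) by (rule Suc.IH)
  finally show ?case by simp
qed

lemma radical_density_ge_inverse_power: "1 / 2 ^ n \<le> radical_density n k f"
proof -
  have "0 \<in> radical n k f"
    by (rule fun_space.subspace_0[OF subspace_radical])
  then have "1 \<le> card (radical n k f)"
    by (simp add: Suc_le_eq card_gt_0_iff) blast
  then show ?thesis
    by (simp add: radical_density_def divide_right_mono)
qed

text \<open>In degree at most 1 the derivative is constant and depends linearly on the direction, so the
  radical, as the kernel of a functional, has index at most 2.\<close>
lemma radical_density_ge_half:
  assumes f: "deg_lt n 2 f"
  shows "1 / 2 \<le> radical_density n 1 f"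
proof (cases "radical n 1 f = Vn n")
  case True
  then show ?thesis by (simp add: radical_density_def card_Vn)
next
  case False
  let ?N = "Vn n - radical n 1 f"
  have der_eq_1: "der u f x = 1" if "u \<in> ?N" "x \<in> Vn n" for u x
    using has_degree_0_imp_eq_1[of n "der u f" x] f that
    by (auto simp: has_degree_def radical_def numeral_2_eq_2 deg_lt_Suc[of n "Suc 0"])
  obtain v where v: "v \<in> ?N"
    using False radical_subset by blast
  have "v + u \<in> radical n 1 f" if u: "u \<in> ?N" for u
  proof -
    have "der (v + u) f x = 0" if x: "x \<in> Vn n" for x
      using der_eq_1[OF v x] der_eq_1[OF u x] der_eq_1[OF u, of "x + v"] v x
      by (simp add: der_add der_def[of v "der u f"])
    then show ?thesis
      using u v by (simp add: radical_def deg_lt_0)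
  qed
  then have "card ((+) v ` ?N) \<le> card (radical n 1 f)"
    by (intro card_mono) auto
  then have "real (card ?N) \<le> real (card (radical n 1 f))"
    by (simp add: card_image)
  then have "(1 - radical_density n 1 f) * 2 ^ n \<le> radical_density n 1 f * 2 ^ n"
    unfolding card_Diff_radical by (simp add: radical_density_def)
  then show ?thesis by simp
qed

subsection \<open>The recursion for the density of nonvanishing derivatives\<close>

lemma sum_PiE_insert:
  assumes "x \<notin> A"
  shows "(\<Sum>g\<in>PiE (insert x A) B. F g) = (\<Sum>y\<in>B x. \<Sum>g\<in>PiE A B. F (g(x := y)))"
  unfolding PiE_insert_eq sum.reindex[OF inj_combinator[OF assms]]
  by (simp add: sum.cartesian_product case_prod_unfold)

lemma kder_fun_upd: "k < i \<Longrightarrow> kder k f (u(i := w)) = kder k f u"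
  unfolding kder_def by (intro sum.cong arg_cong[of _ _ f] ext arg_cong2[of _ _ _ _ "(+)"]) auto

lemma kder_Suc: "kder (Suc k) f u = kder k (der (u (Suc k)) f) u"
proof -
  define base where "base c = (\<lambda>j. (\<Sum>i\<in>{1..k}. c i * u i j) + u 0 j)" for c
  have kder_base: "kder k g u = (\<Sum>c\<in>PiE {1..k} (\<lambda>_. UNIV). g (base c))" for g
    by (simp add: kder_def base_def)
  have base_upd: "(\<lambda>j. (\<Sum>i\<in>{1..Suc k}. (c(Suc k := y)) i * u i j) + u 0 j)
      = base c + scale_fun y (u (Suc k))" for c y
    by (auto simp: base_def scale_fun_def fun_eq_iff add_ac intro!: sum.cong)
  have "{1..Suc k} = insert (Suc k) {1..k}"
    by auto
  then have "PiE {1..Suc k} (\<lambda>_. UNIV :: bit set) = PiE (insert (Suc k) {1..k}) (\<lambda>_. UNIV)"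
    by (rule arg_cong)
  then have "kder (Suc k) f u
      = (\<Sum>y\<in>UNIV. \<Sum>c\<in>PiE {1..k} (\<lambda>_. UNIV). f (base c + scale_fun y (u (Suc k))))"
    unfolding kder_def base_upd[symmetric] by (simp add: sum_PiE_insert)
  then show ?thesis
    by (simp add: sum_UNIV_bit kder_base der_def scale_fun_bit sum.distrib add.commute)
qed

lemma dt_eq_sum:
  "dt n k f = (\<Sum>u\<in>PiE {0..k} (\<lambda>_. Vn n). of_bool (kder k f u \<noteq> 0)) / 2 ^ ((k + 1) * n)"
proof -
  have "finite (PiE {0..k} (\<lambda>_. Vn n))"
    by (intro finite_PiE) auto
  then show ?thesis
    by (simp add: dt_def Int_def del: bit_not_zero_iff)
qed

lemma dt_0: "dt n 0 f = card {x \<in> Vn n. f x \<noteq> 0} / 2 ^ n"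
  by (simp add: dt_eq_sum kder_def sum_PiE_insert Int_def del: bit_not_zero_iff)

lemma dt_Suc: "dt n (Suc k) f = (\<Sum>u\<in>Vn n. dt n k (der u f)) / 2 ^ n"
proof -
  have "{0..Suc k} = insert (Suc k) {0..k}"
    by auto
  then have "dt n (Suc k) f
      = (\<Sum>w\<in>Vn n. \<Sum>u\<in>PiE {0..k} (\<lambda>_. Vn n). of_bool (kder k (der w f) u \<noteq> 0))
        / 2 ^ ((k + 1) * n + n)"
    by (simp add: dt_eq_sum sum_PiE_insert kder_Suc kder_fun_upd add_ac del: bit_not_zero_iff)
  then show ?thesis
    by (simp add: dt_eq_sum power_add flip: sum_divide_distrib)
qed

lemma dt_eq_0_if_deg_lt: "deg_lt n k f \<Longrightarrow> dt n k f = 0"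
proof (induction k arbitrary: f)
  case 0
  then have "{x \<in> Vn n. f x \<noteq> 0} = {}"
    by (auto simp: deg_lt_0)
  then show ?case by (simp only: dt_0 card.empty)
qed (simp add: dt_Suc deg_lt_Suc)

lemma dt_Suc_eq_sum_Diff_radical:
  "dt n (Suc k) f = (\<Sum>u\<in>Vn n - radical n (Suc k) f. dt n k (der u f)) / 2 ^ n"
proof -
  have "(\<Sum>u\<in>Vn n. dt n k (der u f)) = (\<Sum>u\<in>Vn n - radical n (Suc k) f. dt n k (der u f))"
    by (rule sum.mono_neutral_right) (auto simp: radical_def intro: dt_eq_0_if_deg_lt)
  then show ?thesis by (simp add: dt_Suc)
qed

lemma dt_Suc_ge:
  assumes "\<And>u. u \<in> Vn n - radical n (Suc k) f \<Longrightarrow> c \<le> dt n k (der u f)"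
  shows "(1 - radical_density n (Suc k) f) * c \<le> dt n (Suc k) f"
proof -
  have "real (card (Vn n - radical n (Suc k) f)) * c
      \<le> (\<Sum>u\<in>Vn n - radical n (Suc k) f. dt n k (der u f))"
    using assms by (rule sum_bounded_below)
  then show ?thesis
    unfolding card_Diff_radical dt_Suc_eq_sum_Diff_radical by (simp add: field_simps)
qed

lemma dt_Suc_le:
  assumes "\<And>u. u \<in> Vn n - radical n (Suc k) f \<Longrightarrow> dt n k (der u f) \<le> c"
  shows "dt n (Suc k) f \<le> (1 - radical_density n (Suc k) f) * c"
proof -
  have "(\<Sum>u\<in>Vn n - radical n (Suc k) f. dt n k (der u f))
      \<le> real (card (Vn n - radical n (Suc k) f)) * c"
    using assms by (rule sum_bounded_above)
  then show ?thesis
    unfolding card_Diff_radical dt_Suc_eq_sum_Diff_radical by (simp add: field_simps)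
qed

subsection \<open>Bounds on the density\<close>

text \<open>The \<open>q\<close>-Pochhammer symbol \<open>(q; q)_k\<close> at \<open>q = 1/2\<close>.\<close>
definition half_pochhammer :: "nat \<Rightarrow> real" where
  "half_pochhammer k = (\<Prod>i=1..k. 1 - 1 / 2 ^ i)"

lemma half_pochhammer_0 [simp]: "half_pochhammer 0 = 1"
  by (simp add: half_pochhammer_def)

lemma half_pochhammer_Suc: "half_pochhammer (Suc k) = (1 - 1 / 2 ^ Suc k) * half_pochhammer k"
  by (simp add: half_pochhammer_def)

lemma half_pochhammer_pos: "0 < half_pochhammer k"
proof (induction k)
  case (Suc k)
  have "1 / 2 ^ Suc k < (1::real)"
    by (simp add: power_gt1 del: power_Suc)
  with Suc show ?case
    unfolding half_pochhammer_Suc by (intro mult_pos_pos) simp_all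
qed simp

lemma dt_0_eq_1:
  assumes "has_degree n 0 f"
  shows "dt n 0 f = 1"
proof -
  have "{x \<in> Vn n. f x \<noteq> 0} = Vn n"
    using has_degree_0_imp_eq_1[OF assms] by auto
  then show ?thesis by (simp only: dt_0 card_Vn) simp
qed

lemma radical_density_0_eq_1:
  assumes "has_degree n 0 f"
  shows "radical_density n 0 f = 1"
proof -
  have "radical n 0 f = Vn n"
    using assms by (auto simp: radical_def has_degree_def deg_lt_Suc)
  then show ?thesis by (simp add: radical_density_def card_Vn)
qed

lemma dt_ge_half_pochhammer: "has_degree n k f \<Longrightarrow> half_pochhammer k \<le> dt n k f"
proof (induction k arbitrary: f)
  case 0
  then show ?case by (simp add: dt_0_eq_1)
next
  case (Suc k)
  have "radical_density n (Suc k) f \<le> 1 / 2 ^ Suc k"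
    using Suc.prems unfolding has_degree_def by (blast intro: radical_density_le)
  then have "half_pochhammer (Suc k) \<le> (1 - radical_density n (Suc k) f) * half_pochhammer k"
    unfolding half_pochhammer_Suc using half_pochhammer_pos[of k]
    by (intro mult_right_mono) simp_all
  also have "\<dots> \<le> dt n (Suc k) f"
    using Suc by (intro dt_Suc_ge) (simp add: has_degree_der)
  finally show ?case .
qed

lemma dt_eq_half_pochhammer_if_radical_density:
  "has_degree n k f \<Longrightarrow> radical_density n k f = 1 / 2 ^ k \<Longrightarrow> dt n k f = half_pochhammer k"
proof (induction k arbitrary: f)
  case 0
  then show ?case by (simp add: dt_0_eq_1)
next
  case (Suc k)
  have "dt n k (der u f) = half_pochhammer k" if u: "u \<in> Vn n - radical n (Suc k) f" for u
  proof (rule Suc.IH)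
    show der: "has_degree n k (der u f)"
      using Suc.prems(1) u by (rule has_degree_der)
    have "radical_density n k (der u f) \<le> 1 / 2 ^ k"
      using der by (simp add: has_degree_def radical_density_le)
    moreover have "1 / 2 ^ k \<le> radical_density n k (der u f)"
      using radical_density_der[OF u] Suc.prems(2) by simp
    ultimately show "radical_density n k (der u f) = 1 / 2 ^ k"
      by (rule antisym)
  qed
  then have "dt n (Suc k) f = (1 - radical_density n (Suc k) f) * half_pochhammer k"
    by (intro antisym dt_Suc_le dt_Suc_ge) simp_all
  then show ?case by (simp only: Suc.prems(2) half_pochhammer_Suc)
qed

lemma dt_eq_half_pochhammer_iff:
  assumes f: "has_degree n k f"
  shows "dt n k f = half_pochhammer k \<longleftrightarrow> radical_density n k f = 1 / 2 ^ k"
proof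
  assume eq: "dt n k f = half_pochhammer k"
  have "1 / 2 ^ k \<le> radical_density n k f"
  proof (cases k)
    case 0
    then show ?thesis using f by (simp add: radical_density_0_eq_1)
  next
    case (Suc l)
    have "(1 - radical_density n k f) * half_pochhammer l \<le> dt n k f"
      using f unfolding Suc by (intro dt_Suc_ge dt_ge_half_pochhammer has_degree_der)
    also have "\<dots> = (1 - 1 / 2 ^ k) * half_pochhammer l"
      using eq unfolding Suc half_pochhammer_Suc .
    finally have "1 - radical_density n k f \<le> 1 - 1 / 2 ^ k"
      using half_pochhammer_pos by (rule mult_right_le_imp_le)
    then show ?thesis by simp
  qed
  moreover have "radical_density n k f \<le> 1 / 2 ^ k"
    using f by (simp add: has_degree_def radical_density_le)
  ultimately show "radical_density n k f = 1 / 2 ^ k"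
    by simp
qed (rule dt_eq_half_pochhammer_if_radical_density[OF f])

lemma dt_le_half_power:
  "deg_lt n (Suc (Suc k)) f \<Longrightarrow> dt n (Suc k) f \<le> 1 / 2 * (1 - 1 / 2 ^ n) ^ k"
proof (induction k arbitrary: f)
  case 0
  have "dt n 0 g \<le> 1" for g
    using card_mono[OF finite_Vn, of "{x \<in> Vn n. g x \<noteq> 0}" n]
    by (simp add: dt_0 card_Vn del: bit_not_zero_iff)
  then have "dt n 1 f \<le> 1 - radical_density n 1 f"
    using dt_Suc_le[of n 0 f 1] by simp
  also have "\<dots> \<le> 1 / 2"
    using radical_density_ge_half[of n f] 0 by (simp add: numeral_2_eq_2)
  finally show ?case by simp
next
  case (Suc k)
  have "dt n (Suc (Suc k)) f
      \<le> (1 - radical_density n (Suc (Suc k)) f) * (1 / 2 * (1 - 1 / 2 ^ n) ^ k)"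
    using Suc.prems by (intro dt_Suc_le Suc.IH) (auto simp: deg_lt_Suc[of n "Suc (Suc k)"])
  also have "\<dots> \<le> (1 - 1 / 2 ^ n) * (1 / 2 * (1 - 1 / 2 ^ n) ^ k)"
    using radical_density_ge_inverse_power[of n] by (intro mult_right_mono) simp_all
  finally show ?case by simp
qed

subsection \<open>Affine equivalence\<close>

lemma affmap_in_Vn [simp]: "affmap n M v x \<in> Vn n"
  by (simp add: affmap_def Vn_def)

lemma affmap_add: "affmap n M v (x + y) = affmap n M v x + affmap n M 0 y"
  by (auto simp: affmap_def fun_eq_iff algebra_simps sum.distrib)

lemma affmap_compose: "affmap n A 0 (affmap n B 0 x) = affmap n (mat_mult n A B) 0 x"
proof
  fix j
  have "(\<Sum>i<n. A j i * (\<Sum>l<n. B i l * x l)) = (\<Sum>i<n. \<Sum>l<n. A j i * B i l * x l)"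
    by (simp add: sum_distrib_left mult.assoc)
  also have "\<dots> = (\<Sum>l<n. \<Sum>i<n. A j i * B i l * x l)"
    by (rule sum.swap)
  also have "\<dots> = (\<Sum>l<n. mat_mult n A B j l * x l)"
    by (simp add: mat_mult_def sum_distrib_right)
  finally show "affmap n A 0 (affmap n B 0 x) j = affmap n (mat_mult n A B) 0 x j"
    by (simp add: affmap_def)
qed

lemma affmap_ind:
  assumes "S \<subseteq> {..<n}"
  shows "affmap n M 0 (ind S) = (\<lambda>i. if i < n then \<Sum>j\<in>S. M i j else 0)"
proof -
  have "(\<Sum>j<n. M i j * ind S j) = (\<Sum>j\<in>S. M i j)" for i
  proof -
    have "(\<Sum>j<n. M i j * ind S j) = (\<Sum>j<n. if j \<in> S then M i j else 0)"
      by (intro sum.cong) (auto simp: ind_def)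
    then show ?thesis
      using assms by (simp add: Int_absorb1 flip: sum.inter_restrict)
  qed
  then show ?thesis
    by (auto simp: affmap_def fun_eq_iff)
qed

lemma affmap_eq_self_iff:
  "(\<forall>x\<in>Vn n. affmap n A 0 x = x) \<longleftrightarrow> (\<forall>i<n. \<forall>j<n. A i j = (if i = j then 1 else 0))"
proof
  assume fixed: "\<forall>x\<in>Vn n. affmap n A 0 x = x"
  have "A i j = ind {j} i" if "i < n" "j < n" for i j
    using bspec[OF fixed, of "ind {j}"] affmap_ind[of "{j}" n A] that
    by (auto dest: fun_cong[of _ _ i])
  then show "\<forall>i<n. \<forall>j<n. A i j = (if i = j then 1 else 0)"
    by (simp add: ind_def)
next
  assume A: "\<forall>i<n. \<forall>j<n. A i j = (if i = j then 1 else 0)"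
  have "(\<Sum>j<n. A i j * x j) = x i" if "i < n" for i x
  proof -
    have "(\<Sum>j<n. A i j * x j) = (\<Sum>j<n. if i = j then x j else 0)"
      using A that by (intro sum.cong) auto
    then show ?thesis using that by simp
  qed
  then show "\<forall>x\<in>Vn n. affmap n A 0 x = x"
    by (auto simp: affmap_def Vn_def fun_eq_iff)
qed

lemma GL_iff_affmap_inverse:
  "GL n M \<longleftrightarrow> (\<exists>N. (\<forall>x\<in>Vn n. affmap n M 0 (affmap n N 0 x) = x) \<and>
      (\<forall>x\<in>Vn n. affmap n N 0 (affmap n M 0 x) = x))"
  unfolding GL_def affmap_compose affmap_eq_self_iff by blast

lemma GL_iff_bij_betw: "GL n M \<longleftrightarrow> bij_betw (affmap n M 0) (Vn n) (Vn n)"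
proof
  assume "GL n M"
  then obtain N where "\<forall>x\<in>Vn n. affmap n M 0 (affmap n N 0 x) = x"
      "\<forall>x\<in>Vn n. affmap n N 0 (affmap n M 0 x) = x"
    unfolding GL_iff_affmap_inverse by blast
  then show "bij_betw (affmap n M 0) (Vn n) (Vn n)"
    by (intro bij_betw_byWitness[where f' = "affmap n N 0"]) auto
next
  assume bij: "bij_betw (affmap n M 0) (Vn n) (Vn n)"
  define N where "N i j = inv_into (Vn n) (affmap n M 0) (ind {j}) i" for i j
  have "mat_mult n M N i j = (if i = j then 1 else 0)" if "i < n" "j < n" for i j
  proof -
    have "mat_mult n M N i j = affmap n M 0 (inv_into (Vn n) (affmap n M 0) (ind {j})) i"
      using that by (simp add: mat_mult_def N_def affmap_def)
    also have "\<dots> = ind {j} i"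
      using that by (subst bij_betw_inv_into_right[OF bij]) auto
    finally show ?thesis by (simp add: ind_def)
  qed
  then have right: "affmap n M 0 (affmap n N 0 x) = x" if "x \<in> Vn n" for x
    using affmap_eq_self_iff[of n "mat_mult n M N"] that by (simp add: affmap_compose)
  then have "affmap n N 0 (affmap n M 0 x) = x" if "x \<in> Vn n" for x
    using inj_onD[OF bij_betw_imp_inj_on[OF bij], of "affmap n N 0 (affmap n M 0 x)" x] that by simp
  with right show "GL n M"
    unfolding GL_iff_affmap_inverse by blast
qed

lemma affmap_image_Vn:
  assumes "GL n M"
  shows "affmap n M v ` Vn n = Vn n"
proof -
  have "inj_on (affmap n M v) (Vn n)"
  proof (rule inj_onI)
    fix x y assume xy: "x \<in> Vn n" "y \<in> Vn n" "affmap n M v x = affmap n M v y"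
    have "affmap n M v z = affmap n M v 0 + affmap n M 0 z" for z
      using affmap_add[of n M v 0 z] by (simp only: add_0)
    with xy(3) have "affmap n M 0 x = affmap n M 0 y"
      by (metis add_left_imp_eq)
    with xy(1,2) assms show "x = y"
      by (auto simp: GL_iff_bij_betw bij_betw_def inj_on_def)
  qed
  then show ?thesis
    by (intro endo_inj_surj) auto
qed

lemma der_compose_affmap: "der u (f \<circ> affmap n M v) = der (affmap n M 0 u) f \<circ> affmap n M v"
  by (simp add: der_def affmap_add fun_eq_iff)

lemma deg_lt_compose_affmap:
  assumes "GL n M"
  shows "deg_lt n d (f \<circ> affmap n M v) \<longleftrightarrow> deg_lt n d f"
proof (induction d arbitrary: f)
  case 0
  have "deg_lt n 0 (f \<circ> affmap n M v) \<longleftrightarrow> (\<forall>x\<in>affmap n M v ` Vn n. f x = 0)"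
    by (simp add: deg_lt_0)
  then show ?case by (simp only: affmap_image_Vn[OF assms] deg_lt_0)
next
  case (Suc d)
  have "deg_lt n (Suc d) (f \<circ> affmap n M v) \<longleftrightarrow> (\<forall>w\<in>affmap n M 0 ` Vn n. deg_lt n d (der w f))"
    by (simp add: deg_lt_Suc der_compose_affmap Suc.IH)
  then show ?case by (simp only: affmap_image_Vn[OF assms] deg_lt_Suc)
qed

lemma radical_compose_affmap:
  assumes "GL n M"
  shows "radical n k (f \<circ> affmap n M v) = {u \<in> Vn n. affmap n M 0 u \<in> radical n k f}"
  by (simp add: radical_def der_compose_affmap deg_lt_compose_affmap[OF assms])

lemma radical_density_compose_affmap:
  assumes "GL n M"
  shows "radical_density n k (f \<circ> affmap n M v) = radical_density n k f"
proof -
  have "affmap n M 0 ` radical n k (f \<circ> affmap n M v) = affmap n M 0 ` Vn n \<inter> radical n k f"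
    unfolding radical_compose_affmap[OF assms] by auto
  also have "\<dots> = radical n k f"
    using radical_subset by (simp only: affmap_image_Vn[OF assms]) blast
  finally have "bij_betw (affmap n M 0) (radical n k (f \<circ> affmap n M v)) (radical n k f)"
    using assms by (intro bij_betw_subset[OF _ radical_subset]) (simp_all add: GL_iff_bij_betw)
  then show ?thesis
    by (simp add: radical_density_def bij_betw_same_card)
qed

lemma affeq_deg_iff:
  "affeq_deg n d f g \<longleftrightarrow> (\<exists>M v. GL n M \<and> v \<in> Vn n \<and> deg_lt n (Suc d) (g + (f \<circ> affmap n M v)))"
proof
  assume "affeq_deg n d f g"
  then obtain h M v where M: "GL n M" "v \<in> Vn n" and h: "\<forall>x\<in>Vn n. h x = f (affmap n M v x)"
    and "deg_lt n (Suc d) (\<lambda>x. g x + h x)"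
    unfolding affeq_deg_def affeq_def deg_le_iff_deg_lt by blast
  moreover have "deg_lt n (Suc d) (\<lambda>x. g x + h x) \<longleftrightarrow> deg_lt n (Suc d) (g + (f \<circ> affmap n M v))"
    using h by (intro deg_lt_cong) simp
  ultimately show "\<exists>M v. GL n M \<and> v \<in> Vn n \<and> deg_lt n (Suc d) (g + (f \<circ> affmap n M v))"
    by blast
next
  assume "\<exists>M v. GL n M \<and> v \<in> Vn n \<and> deg_lt n (Suc d) (g + (f \<circ> affmap n M v))"
  then show "affeq_deg n d f g"
    unfolding affeq_deg_def affeq_def deg_le_iff_deg_lt plus_fun_def by (metis comp_apply)
qed

lemma affmap_columns:
  assumes "\<And>j. j < n \<Longrightarrow> b j \<in> Vn n" and "S \<subseteq> {..<n}"
  shows "affmap n (\<lambda>i j. b j i) 0 (ind S) = (\<Sum>j\<in>S. b j)"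
proof -
  have "(\<Sum>j\<in>S. b j) i = 0" if "\<not> i < n" for i
    using assms that by (auto simp: sum_fun_apply Vn_def intro!: sum.neutral)
  then show ?thesis
    by (auto simp: affmap_ind[OF assms(2)] sum_fun_apply fun_eq_iff)
qed

lemma GL_columns:
  assumes b: "\<And>j. j < n \<Longrightarrow> b j \<in> Vn n" and bij: "bij_betw (\<lambda>S. \<Sum>j\<in>S. b j) (Pow {..<n}) (Vn n)"
  shows "GL n (\<lambda>i j. b j i)"
proof -
  have "bij_betw (affmap n (\<lambda>i j. b j i) 0 \<circ> ind) (Pow {..<n}) (Vn n)"
    using bij by (rule bij_betw_cong[THEN iffD1, rotated]) (use b in \<open>auto simp: affmap_columns\<close>)
  then show ?thesis
    using bij_betw_comp_iff[OF bij_betw_ind] by (auto simp: GL_iff_bij_betw)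
qed

lemma bij_betw_with_image:
  assumes "finite J" "I \<subseteq> J" "card J = card B" and "finite B" "A \<subseteq> B" "card I = card A"
  obtains b where "bij_betw b J B" "b ` I = A"
proof -
  have fin: "finite I" "finite A"
    using assms finite_subset by auto
  obtain g where g: "bij_betw g I A"
    using finite_same_card_bij[OF fin assms(6)] ..
  have "card (J - I) = card (B - A)"
    using assms fin by (simp add: card_Diff_subset)
  then obtain h where h: "bij_betw h (J - I) (B - A)"
    using finite_same_card_bij[of "J - I" "B - A"] assms(1,4) by auto
  define b where "b j = (if j \<in> I then g j else h j)" for j
  have "bij_betw b (I \<union> (J - I)) (A \<union> (B - A))"
    unfolding b_def using g h by (intro bij_betw_disjoint_Un) (auto simp: disjnt_def)
  moreover have "I \<union> (J - I) = J" "A \<union> (B - A) = B"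
    using assms(2,5) by auto
  moreover have "b ` I = A"
    using bij_betw_imp_surj_on[OF g] by (simp add: b_def)
  ultimately show thesis
    using that by simp
qed

lemma subspace_basis_extension:
  assumes U: "fun_space.subspace U" "U \<subseteq> Vn n" and card_U: "card U = 2 ^ card I" and I: "I \<subseteq> {..<n}"
  obtains b where "bij_betw (\<lambda>S. \<Sum>j\<in>S. b j) (Pow {..<n}) (Vn n)" "b ` {..<n} \<subseteq> Vn n" "b ` I \<subseteq> U"
proof -
  obtain A where A: "A \<subseteq> U" "fun_space.independent A" "U \<subseteq> fun_space.span A"
    by (rule fun_space.maximal_independent_subset)
  obtain B where B: "A \<subseteq> B" "B \<subseteq> Vn n" "fun_space.independent B" "Vn n \<subseteq> fun_space.span B"
    by (rule fun_space.maximal_independent_subset_extend[OF subset_trans[OF A(1) U(2)] A(2)])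
  have fin_B: "finite B"
    using finite_Vn B(2) by (rule rev_finite_subset)
  then have fin_A: "finite A"
    using B(1) by (rule rev_finite_subset)
  have span: "fun_space.span A = U" "fun_space.span B = Vn n"
    using fun_space.span_subspace[OF A(1,3) U(1)] fun_space.span_subspace[OF B(2,4) subspace_Vn]
    by simp_all
  have "card I = card A" "card {..<n} = card B"
    using card_span[OF fin_A A(2)] card_span[OF fin_B B(3)] card_U by (simp_all add: span card_Vn)
  then obtain b where b: "bij_betw b {..<n} B" "b ` I = A"
    using bij_betw_with_image[OF finite_lessThan I _ fin_B B(1)] by blast
  show thesis
  proof
    show "bij_betw (\<lambda>S. \<Sum>j\<in>S. b j) (Pow {..<n}) (Vn n)"
      using bij_betw_indexed_subset_sums_span[OF b(1) fin_B B(3)] unfolding span(2) .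
    show "b ` {..<n} \<subseteq> Vn n"
      using bij_betw_imp_surj_on[OF b(1)] B(2) by simp
    show "b ` I \<subseteq> U"
      using b(2) A(1) by simp
  qed
qed

lemma subspace_coordinates:
  assumes "fun_space.subspace U" "U \<subseteq> Vn n" "card U = 2 ^ card I" and I: "I \<subseteq> {..<n}"
  obtains M where "GL n M" "\<And>j. j \<in> I \<Longrightarrow> affmap n M 0 (ind {j}) \<in> U"
proof -
  obtain b where b: "bij_betw (\<lambda>S. \<Sum>j\<in>S. b j) (Pow {..<n}) (Vn n)" "b ` {..<n} \<subseteq> Vn n" "b ` I \<subseteq> U"
    using assms by (rule subspace_basis_extension)
  show thesis
  proof
    show "GL n (\<lambda>i j. b j i)"
      using b by (intro GL_columns) auto
    show "affmap n (\<lambda>i j. b j i) 0 (ind {j}) \<in> U" if "j \<in> I" for j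
    proof -
      have "affmap n (\<lambda>i j. b j i) 0 (ind {j}) = b j"
        using b(2) I that by (subst affmap_columns) auto
      then show ?thesis using b(3) that by auto
    qed
  qed
qed

lemma radical_density_monomial_ge:
  assumes "S \<subseteq> {..<n}"
  shows "1 / 2 ^ card S \<le> radical_density n k (monomial S)"
proof -
  have fin: "finite S"
    using assms finite_subset by blast
  have "ind ` Pow ({..<n} - S) \<subseteq> radical n k (monomial S)"
    by (auto intro!: ind_in_radical_monomial)
  then have "card (ind ` Pow ({..<n} - S)) \<le> card (radical n k (monomial S))"
    by (intro card_mono finite_radical)
  moreover have "inj_on ind (Pow ({..<n} - S))"
    by (rule inj_on_subset[OF bij_betw_imp_inj_on[OF bij_betw_ind, of n]]) auto
  ultimately have "2 ^ (n - card S) \<le> real (card (radical n k (monomial S)))"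
    using assms fin by (simp add: card_image card_Pow card_Diff_subset)
  moreover have "card S \<le> n"
    using card_mono[OF finite_lessThan assms] by simp
  ultimately show ?thesis
    by (simp add: radical_density_def power_diff field_simps)
qed

lemma affeq_deg_monomial_if_radical_density:
  assumes k: "1 \<le> k" "k \<le> n" and f: "\<not> deg_lt n k f" and "radical_density n k f = 1 / 2 ^ k"
  shows "affeq_deg n (k - 1) f (monomial {..<k})"
proof -
  have "real (card (radical n k f)) = 2 ^ n / 2 ^ k"
    using assms(4) by (simp add: radical_density_def field_simps)
  also have "\<dots> = real (2 ^ (n - k))"
    unfolding of_nat_power using k(2) by (simp add: power_diff)
  finally have "card (radical n k f) = 2 ^ card {k..<n}"
    by (simp only: of_nat_eq_iff card_atLeastLessThan)
  moreover have "{k..<n} \<subseteq> {..<n}"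
    by auto
  ultimately obtain M where M: "GL n M" "\<And>j. j \<in> {k..<n} \<Longrightarrow> affmap n M 0 (ind {j}) \<in> radical n k f"
    by (rule subspace_coordinates[OF subspace_radical radical_subset]) blast
  have "deg_lt n k (monomial {..<k} + (f \<circ> affmap n M 0))"
    using deg_lt_monomial_add[of "{..<k}" n "f \<circ> affmap n M 0"] k(2) f M
    by (simp add: deg_lt_compose_affmap radical_compose_affmap)
  then show ?thesis
    unfolding affeq_deg_iff using M(1) k(1) zero_in_Vn[of n] by (intro exI[of _ M] exI[of _ 0]) simp
qed

lemma radical_density_if_affeq_deg_monomial:
  assumes k: "1 \<le> k" "k \<le> n" and f: "\<not> deg_lt n k f" and "affeq_deg n (k - 1) f (monomial {..<k})"
  shows "radical_density n k f = 1 / 2 ^ k"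
proof (rule antisym)
  obtain M v where M: "GL n M" and lower: "deg_lt n k (monomial {..<k} + (f \<circ> affmap n M v))"
    using assms by (auto simp: affeq_deg_iff)
  have "radical_density n k f = radical_density n k (monomial {..<k})"
    using radical_cong[OF lower] radical_density_compose_affmap[OF M]
    by (simp add: radical_density_def)
  then show "1 / 2 ^ k \<le> radical_density n k f"
    using radical_density_monomial_ge[of "{..<k}" n k] k(2) by simp
qed (rule radical_density_le[OF f])

theorem theorem2:
  fixes n k :: nat and f :: "(nat \<Rightarrow> bit) \<Rightarrow> bit"
  assumes "1 \<le> k" and "k \<le> n" and "deg n f = k"
  shows "(\<Prod>i=1..k. 1 - 1 / (2::real) ^ i) \<le> dt n k f
       \<and> dt n k f \<le> 1 / 2 * (1 - 1 / (2::real) ^ n) ^ (k - 1)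
       \<and> (dt n k f = (\<Prod>i=1..k. 1 - 1 / (2::real) ^ i)
            \<longleftrightarrow> affeq_deg n (k - 1) f (\<lambda>x. \<Prod>i<k. x i))"
proof -
  have f: "has_degree n k f"
    using assms(1,3) by (simp add: has_degree_iff_deg)
  have "dt n k f \<le> 1 / 2 * (1 - 1 / 2 ^ n) ^ (k - 1)"
    using dt_le_half_power[of n "k - 1" f] f assms(1) by (simp add: has_degree_def)
  moreover have "dt n k f = half_pochhammer k \<longleftrightarrow> affeq_deg n (k - 1) f (monomial {..<k})"
    using dt_eq_half_pochhammer_iff[OF f] affeq_deg_monomial_if_radical_density
      radical_density_if_affeq_deg_monomial assms(1,2) f has_degree_def by blast
  ultimately show ?thesis
    using dt_ge_half_pochhammer[OF f] unfolding half_pochhammer_def by blast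
qed

end
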